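(* There exist a closed set $G\subset[0,1]$ with $\dim_{\mathrm P}(G)=1$ and a limsup random fractal $A\subset[0,1]$ (on some probability space $(\Omega,\mathscr{B},\mathbb{P})$) with indices $\gamma_1=\gamma_2=0$ and satisfying the Correlation Condition with constant $\delta=0$, such that $\mathbb{P}(A\cap G\ne\varnothing)=0$.
   Context: $\dim_{\mathrm P}$ denotes packing dimension. For $n\ge 0$, $\mathcal{Q}_n=\{[k2^{-n},(k+1)2^{-n}] : k\in\mathbb{Z},\ 0\le k\le 2^n-1\}$ is the collection of closed dyadic intervals of order $n$ in $[0,1]$. Limsup random fractal: for $n\ge 1$ let $\{Z_n(Q): Q\in\mathcal{Q}_n\}$ be random variables, all defined on one probability space $(\Omega,\mathscr{B},\mathbb{P})$ and taking values in $\{0,1\}$. Put $A(n)=\bigcup_{Q\in\mathcal{Q}_n,\ Z_n(Q)=1}Q$ and $A=\limsup_{n\to\infty}A(n)=\bigcap_{k\ge1}\bigcup_{n\ge k}A(n)$. The random set $A$ is called the limsup random fractal associated to $\{Z_n(Q): n\ge1, Q\in\mathcal{Q}_n\}$. Indices: with $P_n(Q)=\mathbb{P}(Z_n(Q)=1)$ and the convention $\log_2 0=-\infty$, \[\gamma_1=-\limsup_{n\to\infty}\frac{\log_2(\max_{Q\in\mathcal{Q}_n}P_n(Q))}{n},\qquad \gamma_2=-\limsup_{n\to\infty}\frac{\log_2(\min_{Q\in\mathcal{Q}_n}P_n(Q))}{n}.\] Correlation Condition with constant $\delta\ge0$: for all $\epsilon>0$, $\limsup_{n\to\infty}\frac1n\log_2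 f(n,\epsilon)\le\delta$, where \[f(n,\epsilon)=\max_{Q\in\mathcal{Q}_n}\#\{Q'\in\mathcal{Q}_n : \mathrm{Cov}(Z_n(Q),Z_n(Q'))\ge\epsilon P_n(Q)P_n(Q')\}\] and $\mathrm{Cov}$ denotes covariance. *)

theory Defs
  imports "HOL-Probability.Probability"
begin

section \<open>Packing dimension\<close>

text \<open>A packing is an at most countable family of pairwise disjoint closed balls, given by their
  centres (which lie in \<open>E\<close>) and radii; in a Euclidean space the ball of radius \<open>r\<close> has
  diameter \<open>2 * r\<close>.\<close>

definition packings :: "real \<Rightarrow> 'a::euclidean_space set \<Rightarrow> ('a \<times> real) set set" where
  "packings \<delta> E = {C. countable C \<and>
     (\<forall>(x, r)\<in>C. x \<in> E \<and> 0 < r \<and> 2 * r \<le> \<delta>) \<and>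
     disjoint_family_on (\<lambda>(x, r). cball x r) C}"

text \<open>The inner supremum decreases with \<open>\<delta>\<close>, so its limit as \<open>\<delta>\<close> tends to \<open>0\<close> is the infimum.\<close>

definition packing_premeasure :: "real \<Rightarrow> 'a::euclidean_space set \<Rightarrow> ennreal" where
  "packing_premeasure s E =
     (INF \<delta>\<in>{0<..}. SUP C\<in>packings \<delta> E. \<Sum>\<^sub>\<infinity>(x, r)\<in>C. ennreal ((2 * r) powr s))"

definition packing_measure :: "real \<Rightarrow> 'a::euclidean_space set \<Rightarrow> ennreal" where
  "packing_measure s E =
     (INF F\<in>{F :: nat \<Rightarrow> 'a set. E \<subseteq> (\<Union>i. F i)}. \<Sum>i. packing_premeasure s (F i))"

definition packing_dim :: "'a::euclidean_space set \<Rightarrow> ereal" where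
  "packing_dim E = (INF s\<in>{s. 0 \<le> s \<and> packing_measure s E = 0}. ereal s)"

section \<open>Limsup random fractals\<close>

definition dyadic_intervals :: "nat \<Rightarrow> real set set" where
  "dyadic_intervals n = (\<lambda>k::nat. {real k / 2 ^ n .. (real k + 1) / 2 ^ n}) ` {0..2 ^ n - 1}"

locale limsup_random_fractal = prob_space M
  for M :: "'w measure" and Z :: "nat \<Rightarrow> real set \<Rightarrow> 'w \<Rightarrow> real" +
  assumes Z_measurable:
      "\<And>n Q. n \<ge> 1 \<Longrightarrow> Q \<in> dyadic_intervals n \<Longrightarrow> Z n Q \<in> borel_measurable M"
    and Z_values:
      "\<And>n Q \<omega>. n \<ge> 1 \<Longrightarrow> Q \<in> dyadic_intervals n \<Longrightarrow> \<omega> \<in> space M \<Longrightarrow> Z n Q \<omega> \<in> {0, 1}"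

definition fractal_level :: "(nat \<Rightarrow> real set \<Rightarrow> 'w \<Rightarrow> real) \<Rightarrow> nat \<Rightarrow> 'w \<Rightarrow> real set" where
  "fractal_level Z n \<omega> = \<Union>{Q \<in> dyadic_intervals n. Z n Q \<omega> = 1}"

definition limsup_fractal :: "(nat \<Rightarrow> real set \<Rightarrow> 'w \<Rightarrow> real) \<Rightarrow> 'w \<Rightarrow> real set" where
  "limsup_fractal Z \<omega> = (\<Inter>k\<in>{1..}. \<Union>n\<in>{k..}. fractal_level Z n \<omega>)"

definition hit_prob :: "'w measure \<Rightarrow> (nat \<Rightarrow> real set \<Rightarrow> 'w \<Rightarrow> real) \<Rightarrow> nat \<Rightarrow> real set \<Rightarrow> real" where
  "hit_prob M Z n Q = measure M {\<omega> \<in> space M. Z n Q \<omega> = 1}"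

text \<open>Only used for \<open>x \<ge> 0\<close>.\<close>

definition elog2 :: "real \<Rightarrow> ereal" where
  "elog2 x = (if x = 0 then -\<infinity> else ereal (log 2 x))"

definition gamma1 :: "'w measure \<Rightarrow> (nat \<Rightarrow> real set \<Rightarrow> 'w \<Rightarrow> real) \<Rightarrow> ereal" where
  "gamma1 M Z =
     - limsup (\<lambda>n. elog2 (MAX Q\<in>dyadic_intervals n. hit_prob M Z n Q) / ereal (real n))"

definition gamma2 :: "'w measure \<Rightarrow> (nat \<Rightarrow> real set \<Rightarrow> 'w \<Rightarrow> real) \<Rightarrow> ereal" where
  "gamma2 M Z =
     - limsup (\<lambda>n. elog2 (MIN Q\<in>dyadic_intervals n. hit_prob M Z n Q) / ereal (real n))"

definition covariance :: "'w measure \<Rightarrow> ('w \<Rightarrow> real) \<Rightarrow> ('w \<Rightarrow> real) \<Rightarrow> real" where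
  "covariance M X Y =
     (\<integral>\<omega>. (X \<omega> - (\<integral>\<omega>'. X \<omega>' \<partial>M)) * (Y \<omega> - (\<integral>\<omega>'. Y \<omega>' \<partial>M)) \<partial>M)"

definition correlation_count ::
    "'w measure \<Rightarrow> (nat \<Rightarrow> real set \<Rightarrow> 'w \<Rightarrow> real) \<Rightarrow> nat \<Rightarrow> real \<Rightarrow> nat" where
  "correlation_count M Z n \<epsilon> =
     (MAX Q\<in>dyadic_intervals n.
        card {Q' \<in> dyadic_intervals n.
          covariance M (Z n Q) (Z n Q') \<ge> \<epsilon> * hit_prob M Z n Q * hit_prob M Z n Q'})"

definition correlation_condition ::
    "'w measure \<Rightarrow> (nat \<Rightarrow> real set \<Rightarrow> 'w \<Rightarrow> real) \<Rightarrow> real \<Rightarrow> bool" where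
  "correlation_condition M Z \<delta> \<longleftrightarrow> \<delta> \<ge> 0 \<and>
     (\<forall>\<epsilon>>0. limsup (\<lambda>n. elog2 (real (correlation_count M Z n \<epsilon>)) / ereal (real n)) \<le> ereal \<delta>)"

end

theory Submission
  imports Defs "HOL-Real_Asymp.Real_Asymp"
begin

text \<open>
  Put \<open>t j = 2 ^ 2 ^ j\<close> and let \<open>G\<close> be the closure of the set of points whose binary digits in the
  positions from \<open>t (2*k) + 1\<close> to \<open>t (2*k+1)\<close> vanish for all \<open>k\<close>. Near each of its points, \<open>G\<close> contains
  about \<open>2 ^ (m - n)\<close> points of mutual distance \<open>2 ^ - m\<close>, where \<open>n = t (2*k+1)\<close> and \<open>m = n\<^sup>2\<close>. Hence every
  set that is dense in a relatively open part of \<open>G\<close> has infinite \<open>s\<close>-dimensional packing premeasure for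
  all \<open>s < 1\<close>, and by Baire's theorem every countable cover of \<open>G\<close> has such a member.

  On the other hand, at the sparse orders \<open>n = t (2*k+1)\<close> only \<open>3 * 2 ^ sqrt n\<close> dyadic intervals meet
  \<open>G\<close>. Let the variables of one order be independent, with hitting probability \<open>4 powr - sqrt n\<close> at these
  orders and \<open>4 powr - n\<close> at all others. Since \<open>\<gamma>\<^sub>1\<close> and \<open>\<gamma>\<^sub>2\<close> are defined by an upper limit, the sparse
  orders alone make both vanish, while the expected number of hit intervals meeting \<open>G\<close> is summable,
  so that the Borel--Cantelli lemma applies. The probabilities must stay positive at the other orders:
  for probability zero every pair of intervals would count in the Correlation Condition.
\<close>

section \<open>Bounds for the packing dimension\<close>

lemma finite_packing_sum_le:
  fixes C :: "(real \<times> real) set"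
  assumes "finite C" "C \<in> packings \<delta> E" "E \<subseteq> {0..1}" "1 \<le> s" "0 < \<delta>"
  shows "(\<Sum>(x, r)\<in>C. (2 * r) powr s) \<le> \<delta> powr (s - 1) * (1 + 2 * \<delta>)"
proof -
  have C: "x \<in> E" "0 < r" "2 * r \<le> \<delta>" if "(x, r) \<in> C" for x r
    using assms(2) that by (auto simp: packings_def)
  \<comment> \<open>One factor \<open>2 * r\<close> is kept as the length of the ball; the remaining
    power \<open>s - 1\<close> is nonnegative and hence bounded by that of \<open>\<delta>\<close>.
    The balls are disjoint intervals inside \<open>{-\<delta>..1 + \<delta>}\<close>, which bounds
    the sum of their lengths.\<close>
  have "(\<Sum>(x, r)\<in>C. (2 * r) powr s) \<le> (\<Sum>(x, r)\<in>C. \<delta> powr (s - 1) * (2 * r))"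
  proof (rule sum_mono, clarify)
    fix x r assume xr: "(x, r) \<in> C"
    have "(2 * r) powr s = (2 * r) powr (s - 1) * (2 * r)"
      using C(2)[OF xr] by (simp add: powr_mult_base mult.commute)
    also have "\<dots> \<le> \<delta> powr (s - 1) * (2 * r)"
      using C[OF xr] assms(4) by (intro mult_right_mono powr_mono2) auto
    finally show "(2 * r) powr s \<le> \<delta> powr (s - 1) * (2 * r)" .
  qed
  also have "\<dots> = \<delta> powr (s - 1) * (\<Sum>(x, r)\<in>C. 2 * r)"
    by (simp add: sum_distrib_left case_prod_unfold)
  also have "(\<Sum>(x, r)\<in>C. 2 * r) = (\<Sum>i\<in>C. measure lborel ((\<lambda>(x, r). cball x r) i))"
    using C by (intro sum.cong) (auto simp: cball_eq_atLeastAtMost less_imp_le)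
  also have "\<dots> = measure lborel (\<Union>i\<in>C. (\<lambda>(x, r). cball x r) i)"
    using assms(1,2)
    by (intro measure_finite_Union[symmetric])
       (auto simp: packings_def cball_eq_atLeastAtMost emeasure_lborel_Icc_eq)
  also have "\<dots> \<le> measure lborel {-\<delta>..1 + \<delta>}"
  proof (rule measure_mono_fmeasurable)
    show "(\<Union>i\<in>C. (\<lambda>(x, r). cball x r) i) \<subseteq> {-\<delta>..1 + \<delta>}"
      using C assms(3) by (fastforce simp: cball_eq_atLeastAtMost)
    show "(\<Union>i\<in>C. (\<lambda>(x, r). cball x r) i) \<in> sets lborel"
      using assms(1) by (intro sets.finite_UN) (auto simp: cball_eq_atLeastAtMost)
  qed (rule fmeasurable_compact, simp)
  also have "\<dots> = 1 + 2 * \<delta>"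
    using assms(5) by simp
  finally show ?thesis
    by (simp add: mult_left_mono)
qed

lemma packing_subset: "C \<in> packings \<delta> E \<Longrightarrow> F \<subseteq> C \<Longrightarrow> F \<in> packings \<delta> E"
  unfolding packings_def by (blast intro: countable_subset disjoint_family_on_mono)

lemma packing_premeasure_unit_interval:
  assumes "E \<subseteq> {0..1::real}" "1 < s"
  shows "packing_premeasure s E = 0"
proof -
  let ?f = "\<lambda>\<delta>::real. \<delta> powr (s - 1) * (1 + 2 * \<delta>)"
  have le: "packing_premeasure s E \<le> ennreal (?f \<delta>)" if "\<delta> > 0" for \<delta>
    unfolding packing_premeasure_def
  proof (rule INF_lower2)
    show "(SUP C\<in>packings \<delta> E. \<Sum>\<^sub>\<infinity>(x, r)\<in>C. ennreal ((2 * r) powr s)) \<le> ennreal (?f \<delta>)"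
    proof (rule SUP_least)
      fix C assume C: "C \<in> packings \<delta> E"
      show "(\<Sum>\<^sub>\<infinity>(x, r)\<in>C. ennreal ((2 * r) powr s)) \<le> ennreal (?f \<delta>)"
      \<comment> \<open>In \<open>ennreal\<close> the infinite sum is the supremum of its finite
        partial sums, and every finite subfamily of a packing is again a packing.\<close>
      proof (subst nonneg_infsum_complete)
        show "(SUP F\<in>{F. finite F \<and> F \<subseteq> C}. \<Sum>(x, r)\<in>F. ennreal ((2 * r) powr s)) \<le> ennreal (?f \<delta>)"
        proof (rule SUP_least)
          fix F assume F: "F \<in> {F. finite F \<and> F \<subseteq> C}"
          have "(\<Sum>(x, r)\<in>F. ennreal ((2 * r) powr s)) = ennreal (\<Sum>(x, r)\<in>F. (2 * r) powr s)"
            by (simp add: case_prod_unfold flip: sum_ennreal)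
          also have "\<dots> \<le> ennreal (?f \<delta>)"
            using F packing_subset[OF C, of F] that assms
            by (intro ennreal_leI finite_packing_sum_le[where E = E]) auto
          finally show "(\<Sum>(x, r)\<in>F. ennreal ((2 * r) powr s)) \<le> ennreal (?f \<delta>)" .
        qed
      qed auto
    qed
  qed (use that in auto)
  have "(?f \<longlongrightarrow> 0) (at_right 0)"
    using assms(2) by real_asymp
  then have "((\<lambda>\<delta>. ennreal (?f \<delta>)) \<longlongrightarrow> ennreal 0) (at_right 0)"
    by (rule tendsto_ennrealI)
  moreover have "\<forall>\<^sub>F \<delta> in at_right 0. packing_premeasure s E \<le> ennreal (?f \<delta>)"
    using le by (intro eventually_at_rightI[of 0 1]) auto
  ultimately have "packing_premeasure s E \<le> ennreal 0"
    by (rule tendsto_lowerbound) simp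
  then show ?thesis by simp
qed

lemma packing_dim_unit_interval_le:
  assumes "E \<subseteq> {0..1::real}"
  shows "packing_dim E \<le> 1"
proof (rule dense_ge)
  fix z :: ereal assume z: "1 < z"
  show "packing_dim E \<le> z"
  proof (cases z)
    case (real s)
    \<comment> \<open>The constant cover by \<open>E\<close> itself is enough.\<close>
    have "packing_measure s E \<le> (\<Sum>i::nat. packing_premeasure s E)"
      unfolding packing_measure_def by (rule INF_lower) auto
    then have "packing_measure s E = 0"
      using packing_premeasure_unit_interval[OF assms] z real by simp
    then show ?thesis
      unfolding packing_dim_def real using z real by (intro INF_lower) auto
  qed (use z in auto)
qed

section \<open>Lower bounds by Baire's theorem\<close>

lemma closed_countable_cover_portion:
  fixes G :: "'a::euclidean_space set" and F :: "nat \<Rightarrow> 'a set"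
  assumes "closed G" "G \<noteq> {}" "G \<subseteq> (\<Union>i. F i)"
  obtains i U where "open U" "U \<inter> G \<noteq> {}" "U \<inter> G \<subseteq> closure (F i)"
proof (rule ccontr)
  note cover_thesis = that
  assume *: "\<not> thesis"
  have no: "\<not> U \<inter> G \<subseteq> closure (F i)" if U: "open U" "U \<inter> G \<noteq> {}" for i U
    using * cover_thesis[OF U] by blast
  \<comment> \<open>If no nonempty portion of \<open>G\<close> lies in some
    \<open>closure (F i)\<close>, each \<open>G - closure (F i)\<close> is relatively open and dense
    in \<open>G\<close>. Baire makes the intersection dense in \<open>G\<close>, yet the cover makes
    it empty.\<close>
  have "G \<subseteq> closure (\<Inter>(range (\<lambda>i. G - closure (F i))))"
  proof (rule Baire[OF assms(1)])
    fix T assume "T \<in> range (\<lambda>i. G - closure (F i))"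
    then obtain i where T: "T = G - closure (F i)" by blast
    have "openin (top_of_set G) T"
      unfolding T Diff_eq by (rule openin_open_Int) (simp add: open_Compl)
    moreover have "G \<subseteq> closure T"
    proof
      fix x assume "x \<in> G"
      have "T \<inter> W \<noteq> {}" if W: "open W" "x \<in> W" for W
        using no[OF W(1), of i] W(2) \<open>x \<in> G\<close> unfolding T by blast
      then show "x \<in> closure T"
        unfolding closure_iff_nhds_not_empty by blast
    qed
    ultimately show "openin (top_of_set G) T \<and> G \<subseteq> closure T" ..
  qed simp
  moreover have "(\<Inter>i. G - closure (F i)) = {}"
    using assms(3) closure_subset by blast
  ultimately show False using assms(2) by (simp only: closure_empty subset_empty)
qed

lemma one_le_packing_dim:
  fixes G :: "'a::euclidean_space set"
  assumes "closed G" "G \<noteq> {}"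
    and "\<And>s F U. 0 \<le> s \<Longrightarrow> s < 1 \<Longrightarrow> open U \<Longrightarrow> U \<inter> G \<noteq> {} \<Longrightarrow> U \<inter> G \<subseteq> closure F
           \<Longrightarrow> packing_premeasure s F = \<infinity>"
  shows "1 \<le> packing_dim G"
  unfolding packing_dim_def
proof (rule INF_greatest)
  fix s assume s: "s \<in> {s. 0 \<le> s \<and> packing_measure s G = 0}"
  have "packing_measure s G = \<infinity>" if "s < 1"
  proof -
    have "\<infinity> \<le> (\<Sum>i. packing_premeasure s (F i))" if F: "G \<subseteq> (\<Union>i. F i)" for F :: "nat \<Rightarrow> 'a set"
    proof -
      obtain i U where "open U" "U \<inter> G \<noteq> {}" "U \<inter> G \<subseteq> closure (F i)"
        using closed_countable_cover_portion[OF assms(1,2) F] .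
      then have "packing_premeasure s (F i) = \<infinity>"
        using s \<open>s < 1\<close> by (intro assms(3)) auto
      moreover have "packing_premeasure s (F i) \<le> (\<Sum>i. packing_premeasure s (F i))"
        using sum_le_suminf[of "\<lambda>i. packing_premeasure s (F i)" "{i}"] by simp
      ultimately show ?thesis by simp
    qed
    then have "\<infinity> \<le> packing_measure s G"
      unfolding packing_measure_def by (intro INF_greatest) auto
    then show ?thesis by (simp add: top_unique)
  qed
  with s have "1 \<le> s" by force
  then show "1 \<le> ereal s" by simp
qed

section \<open>A sparse set of packing dimension one\<close>

text \<open>Floors encode binary prefixes: the first \<open>N\<close> digits arise from the first
  \<open>n\<close> by dropping the last \<open>n - N\<close>. Two points that agree up to order
  \<open>n\<close> therefore agree at all smaller orders.\<close>

lemma floor_mult_pow_div: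
  fixes x :: real
  assumes "N \<le> n"
  shows "\<lfloor>x * 2 ^ N\<rfloor> = \<lfloor>x * 2 ^ n\<rfloor> div 2 ^ (n - N)"
proof -
  have "(2::real) ^ n = 2 ^ N * 2 ^ (n - N)"
    using assms by (simp flip: power_add)
  then have "x * 2 ^ N = x * 2 ^ n / real_of_int (2 ^ (n - N))"
    by simp
  then show ?thesis
    using floor_divide_real_eq_div[of "2 ^ (n - N)" "x * 2 ^ n"] by (simp only:) simp
qed

text \<open>Each term is the square of the one before, so every block of digits is negligible
  against the next. Up to position \<open>n = tower (2*k+1)\<close> only the first
  \<open>sqrt n\<close> digits can be nonzero, while up to position \<open>n ^ 2\<close> at most
  \<open>n\<close> digits are constrained.\<close>

definition tower :: "nat \<Rightarrow> nat" where
  "tower j = 2 ^ 2 ^ j"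

lemma tower_pos [simp]: "0 < tower j"
  by (simp add: tower_def)

lemma tower_Suc: "tower (Suc j) = tower j ^ 2"
  by (simp add: tower_def power_mult[symmetric] mult.commute)

lemma strict_mono_tower: "strict_mono tower"
  by (auto simp: strict_mono_def tower_def)

lemma tower_le_iff [simp]: "tower i \<le> tower j \<longleftrightarrow> i \<le> j"
  by (simp add: strict_mono_tower strict_mono_less_eq)

text \<open>The divisibility says that the binary digits of \<open>x\<close> in the positions \<open>tower (2*k) + 1\<close> to
  \<open>tower (2*k+1)\<close> vanish; all other digits are free.\<close>

definition sparse_points :: "real set" where
  "sparse_points =
     {x \<in> {0..<1}. \<forall>k. 2 ^ (tower (2*k+1) - tower (2*k)) dvd \<lfloor>x * 2 ^ tower (2*k+1)\<rfloor>}"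

definition sparse_set :: "real set" where
  "sparse_set = closure sparse_points"

lemma zero_in_sparse_points: "0 \<in> sparse_points"
  by (simp add: sparse_points_def)

lemma sparse_set_subset: "sparse_set \<subseteq> {0..1}"
  unfolding sparse_set_def by (rule closure_minimal) (auto simp: sparse_points_def)

text \<open>The point \<open>y\<close> keeps the first \<open>n\<close> digits of \<open>x\<close>,
  carries the digits of \<open>i\<close> in the free positions \<open>n + 1\<close> to
  \<open>m\<close>, and has zeros afterwards. Constraints with index at most \<open>k\<close> see
  only the prefix shared with \<open>x\<close>; the later ones concern positions beyond
  \<open>m\<close>. The shared prefix also gives the distance bound.\<close>

lemma sparse_points_refine:
  fixes k :: nat
  defines "n \<equiv> tower (2*k+1)" and "m \<equiv> tower (2*k+2)"
  assumes x: "x \<in> sparse_points" and i: "i < (2::nat) ^ (m - n)"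
  defines "y \<equiv> of_int \<lfloor>x * 2 ^ n\<rfloor> / 2 ^ n + real i / 2 ^ m"
  shows "y \<in> sparse_points" "\<bar>y - x\<bar> \<le> 1 / 2 ^ n"
proof -
  define q where "q = \<lfloor>x * 2 ^ n\<rfloor>"
  have nm: "n \<le> m" by (simp add: n_def m_def)
  have yn: "y * 2 ^ n = q + real i / 2 ^ (m - n)"
    using nm by (simp add: y_def q_def field_simps power_diff)
  have i': "real i / 2 ^ (m - n) < 1"
    using i by (simp add: field_simps)
  have fl: "\<lfloor>y * 2 ^ n\<rfloor> = \<lfloor>x * 2 ^ n\<rfloor>"
    unfolding yn q_def[symmetric] using i' by (simp add: floor_eq_iff)
  have fl_le: "\<lfloor>y * 2 ^ N\<rfloor> = \<lfloor>x * 2 ^ N\<rfloor>" if "N \<le> n" for N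
    using floor_mult_pow_div[OF that, of x] floor_mult_pow_div[OF that, of y] fl by simp
  have "\<lfloor>y\<rfloor> = \<lfloor>x\<rfloor>" using fl_le[of 0] by simp
  also have "\<dots> = 0" using x by (simp add: sparse_points_def floor_eq_iff)
  finally have y01: "y \<in> {0..<1}" by (auto simp: floor_eq_iff)
  have "2 ^ (tower (2*l+1) - tower (2*l)) dvd \<lfloor>y * 2 ^ tower (2*l+1)\<rfloor>" for l
  proof (cases "l \<le> k")
    case True
    then have "tower (2*l+1) \<le> n" by (simp add: n_def)
    then show ?thesis using x fl_le by (simp add: sparse_points_def)
  next
    case False
    then have M: "m \<le> tower (2*l)" by (simp add: m_def)
    have MN: "tower (2*l) \<le> tower (2*l+1)" by simp
    have "y * 2 ^ tower (2*l+1) = real_of_int ((q * 2 ^ (m - n) + int i) * 2 ^ (tower (2*l+1) - m))"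
    proof -
      have "(2::real) ^ m = 2 ^ n * 2 ^ (m - n)"
        using nm by (simp flip: power_add)
      moreover have "(2::real) ^ tower (2*l+1) = 2 ^ m * 2 ^ (tower (2*l+1) - m)"
        using le_trans[OF M MN] by (simp flip: power_add)
      ultimately show ?thesis
        unfolding y_def q_def by (simp add: field_simps)
    qed
    then have "\<lfloor>y * 2 ^ tower (2*l+1)\<rfloor> = (q * 2 ^ (m - n) + int i) * 2 ^ (tower (2*l+1) - m)"
      by (simp only: floor_of_int)
    moreover have "(2::int) ^ (tower (2*l+1) - tower (2*l)) dvd 2 ^ (tower (2*l+1) - m)"
      using M by (intro le_imp_power_dvd) auto
    ultimately show ?thesis by simp
  qed
  with y01 show "y \<in> sparse_points" by (simp add: sparse_points_def)
  have "y * 2 ^ n < q + 1" "q \<le> y * 2 ^ n" "x * 2 ^ n < q + 1" "q \<le> x * 2 ^ n"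
    using yn i' by (auto simp: q_def floor_correct)
  then have "\<bar>y * 2 ^ n - x * 2 ^ n\<bar> \<le> 1" by linarith
  moreover have "\<bar>y * 2 ^ n - x * 2 ^ n\<bar> = \<bar>y - x\<bar> * 2 ^ n"
    by (simp add: abs_mult flip: left_diff_distrib)
  ultimately show "\<bar>y - x\<bar> \<le> 1 / 2 ^ n" by (simp add: field_simps)
qed

text \<open>A point of \<open>sparse_points\<close> in \<open>U\<close> has
  \<open>2 ^ (m - n)\<close> companions from \<open>sparse_points_refine\<close>, all in
  \<open>U\<close> once \<open>2 ^ - n\<close> is small. Small balls around nearby points of
  \<open>F\<close> form packings with arbitrarily large sums, for every
  \<open>\<delta>\<close>.\<close>

lemma packing_premeasure_sparse_portion:
  assumes s: "0 \<le> s" "s < 1" and U: "open U" "U \<inter> sparse_set \<noteq> {}" "U \<inter> sparse_set \<subseteq> closure F"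
  shows "packing_premeasure s F = \<infinity>"
proof -
  obtain x where x: "x \<in> U" "x \<in> sparse_points"
    using U(1,2) unfolding sparse_set_def by (metis IntE disjoint_iff open_Int_closure_eq_empty)
  obtain \<rho> where \<rho>: "\<rho> > 0" "ball x \<rho> \<subseteq> U"
    using U(1) x(1) open_contains_ball by blast
  have "(SUP C\<in>packings \<delta> F. \<Sum>\<^sub>\<infinity>(x, r)\<in>C. ennreal ((2 * r) powr s)) = \<infinity>" if \<delta>: "\<delta> > 0" for \<delta>
  proof -
    have "\<exists>C\<in>packings \<delta> F. B < (\<Sum>\<^sub>\<infinity>(x, r)\<in>C. ennreal ((2 * r) powr s))" if "B < \<infinity>" for B
    proof -
      obtain b where b: "B = ennreal b" "0 \<le> b" using \<open>B < \<infinity>\<close> by (cases B) auto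
      have lim: "filterlim (\<lambda>k. tower (2*k+1)) at_top sequentially"
        by (rule filterlim_subseq) (auto simp: strict_mono_def tower_def)
      have "\<forall>\<^sub>F n::nat in sequentially. 1 / 2 ^ n < \<rho>"
           "\<forall>\<^sub>F n::nat in sequentially. 1 / 2 ^ n < \<delta>"
        using \<rho>(1) \<delta> by real_asymp+
      \<comment> \<open>The right-hand side is the sum over \<open>2 ^ (m - n)\<close> balls of
        diameter \<open>2 ^ - m / 2\<close> with \<open>m = n ^ 2\<close>. Its exponent
        \<open>(1 - s) * n ^ 2 - n - s\<close> tends to infinity.\<close>
      moreover have "\<forall>\<^sub>F n::nat in sequentially.
          b < 2 powr ((real n)\<^sup>2 - real n) * (1/2 / 2 powr ((real n)\<^sup>2)) powr s"
        using s by real_asymp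
      ultimately have "\<forall>\<^sub>F n::nat in sequentially. 1 / 2 ^ n < \<rho> \<and> 1 / 2 ^ n < \<delta> \<and>
          b < 2 powr ((real n)\<^sup>2 - real n) * (1/2 / 2 powr ((real n)\<^sup>2)) powr s"
        by eventually_elim auto
      then have "\<forall>\<^sub>F k in sequentially. 1 / 2 ^ tower (2*k+1) < \<rho> \<and> 1 / 2 ^ tower (2*k+1) < \<delta> \<and>
          b < 2 powr ((real (tower (2*k+1)))\<^sup>2 - real (tower (2*k+1)))
                * (1/2 / 2 powr ((real (tower (2*k+1)))\<^sup>2)) powr s"
        by (rule eventually_compose_filterlim[OF _ lim])
      then obtain k where k: "1 / 2 ^ tower (2*k+1) < \<rho>" "1 / 2 ^ tower (2*k+1) < \<delta>"
          "b < 2 powr ((real (tower (2*k+1)))\<^sup>2 - real (tower (2*k+1)))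
                * (1/2 / 2 powr ((real (tower (2*k+1)))\<^sup>2)) powr s"
        by (auto simp: eventually_sequentially)
      define n m where "n = tower (2*k+1)" and "m = tower (2*k+2)"
      have m: "m = n ^ 2" using tower_Suc[of "2*k+1"] by (simp add: m_def n_def)
      have nm: "n \<le> m" by (simp add: m_def n_def)
      define y where "y i = of_int \<lfloor>x * 2 ^ n\<rfloor> / 2 ^ n + real i / 2 ^ m" for i
      \<comment> \<open>A quarter of the spacing of the \<open>y i\<close>: moving two of them by
        less than \<open>r / 2\<close> each leaves a distance above \<open>3 * r\<close>, enough for
        disjoint balls of radius \<open>r\<close>.\<close>
      define r :: real where "r = 1 / 2 ^ m / 4"
      have r: "r > 0" by (simp add: r_def)
      \<comment> \<open>The centres of a packing of \<open>F\<close> have to lie in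
        \<open>F\<close>, whereas \<open>y i\<close> is only known to lie in its closure.\<close>
      have approx: "\<exists>z\<in>F. dist z (y i) < r / 2" if "i < 2 ^ (m - n)" for i
      proof -
        have y: "y i \<in> sparse_points" "\<bar>y i - x\<bar> \<le> 1 / 2 ^ n"
          using sparse_points_refine[OF x(2), of i k] that by (simp_all add: y_def n_def m_def)
        then have "y i \<in> ball x \<rho>" using k(1) by (simp add: dist_real_def n_def)
        then have "y i \<in> closure F"
          using \<rho>(2) y(1) U(3) closure_subset unfolding sparse_set_def by blast
        then show ?thesis using r unfolding closure_approachable by (meson half_gt_zero)
      qed
      define z where "z i = (SOME z. z \<in> F \<and> dist z (y i) < r / 2)" for i
      have z: "z i \<in> F" "\<bar>z i - y i\<bar> < r / 2" if "i < 2 ^ (m - n)" for i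
        using someI_ex[OF approx[OF that, unfolded Bex_def]] by (simp_all add: z_def dist_real_def)
      have sep: "\<bar>z i - z j\<bar> > 2 * r" if "i < 2 ^ (m - n)" "j < 2 ^ (m - n)" "i \<noteq> j" for i j
      proof -
        have "y i - y j = (real i - real j) * (4 * r)"
          by (simp add: y_def r_def diff_divide_distrib)
        moreover have "\<bar>real i - real j\<bar> \<ge> 1" using that(3) by linarith
        ultimately have "\<bar>y i - y j\<bar> \<ge> 4 * r"
          using mult_right_mono[of 1 "\<bar>real i - real j\<bar>" "4 * r"] r by (simp add: abs_mult)
        then show ?thesis using z(2)[OF that(1)] z(2)[OF that(2)] r by linarith
      qed
      define C where "C = (\<lambda>i. (z i, r)) ` {..<2 ^ (m - n)}"
      have inj: "inj_on (\<lambda>i. (z i, r)) {..<2 ^ (m - n)}"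
      proof (rule inj_onI)
        fix i j assume *: "i \<in> {..<2 ^ (m - n)}" "j \<in> {..<2 ^ (m - n)}" "(z i, r) = (z j, r)"
        show "i = j"
        proof (rule ccontr)
          assume "i \<noteq> j"
          then show False using sep[of i j] * r by simp
        qed
      qed
      have "C \<in> packings \<delta> F"
      proof -
        have "2 * r \<le> 1 / 2 ^ m" by (simp add: r_def field_simps)
        also have "\<dots> \<le> 1 / 2 ^ n" using nm by (simp add: field_simps)
        finally have "2 * r \<le> \<delta>" using k(2) by (simp add: n_def)
        moreover have "disjoint_family_on (\<lambda>(x, r). cball x r) C"
          unfolding disjoint_family_on_def
        proof (intro ballI impI)
          fix p q assume "p \<in> C" "q \<in> C" "p \<noteq> q"
          then obtain i j where ij: "i < 2 ^ (m - n)" "j < 2 ^ (m - n)" "i \<noteq> j"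
              "p = (z i, r)" "q = (z j, r)"
            by (auto simp: C_def)
          have "cball (z i) r \<inter> cball (z j) r = {}"
          proof (rule ccontr)
            assume "cball (z i) r \<inter> cball (z j) r \<noteq> {}"
            then obtain w where "\<bar>z i - w\<bar> \<le> r" "\<bar>z j - w\<bar> \<le> r"
              by (auto simp: dist_real_def)
            then show False using sep[OF ij(1-3)] by linarith
          qed
          then show "(case p of (x, r) \<Rightarrow> cball x r) \<inter> (case q of (x, r) \<Rightarrow> cball x r) = {}"
            by (simp add: ij)
        qed
        ultimately show ?thesis
          using z(1) r by (auto simp: packings_def C_def)
      qed
      moreover have "B < (\<Sum>\<^sub>\<infinity>(x, r)\<in>C. ennreal ((2 * r) powr s))"
      proof -
        have "(\<Sum>\<^sub>\<infinity>(x, r)\<in>C. ennreal ((2 * r) powr s)) = (\<Sum>(x, r)\<in>C. ennreal ((2 * r) powr s))"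
          by (simp add: C_def)
        also have "\<dots> = of_nat (2 ^ (m - n)) * ennreal ((2 * r) powr s)"
          by (simp add: C_def sum.reindex[OF inj])
        also have "\<dots> = ennreal (2 ^ (m - n) * (2 * r) powr s)"
          by (simp add: ennreal_mult ennreal_power[symmetric])
        also have "2 ^ (m - n) = 2 powr ((real n)\<^sup>2 - real n)"
          using nm by (simp add: m powr_realpow[symmetric] of_nat_diff)
        also have "2 * r = 1/2 / 2 powr ((real n)\<^sup>2)"
          by (simp add: r_def m powr_realpow[symmetric])
        finally show ?thesis
          using k(3) b by (simp add: n_def ennreal_lessI)
      qed
      ultimately show ?thesis by blast
    qed
    then show ?thesis unfolding infinity_ennreal_def SUP_eq_top_iff by blast
  qed
  then show ?thesis by (simp add: packing_premeasure_def)
qed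

lemma packing_dim_sparse_set: "packing_dim sparse_set = 1"
proof (rule antisym)
  show "packing_dim sparse_set \<le> 1"
    by (rule packing_dim_unit_interval_le[OF sparse_set_subset])
  show "1 \<le> packing_dim sparse_set"
  proof (rule one_le_packing_dim)
    show "sparse_set \<noteq> {}"
      using zero_in_sparse_points closure_subset unfolding sparse_set_def by blast
  qed (simp add: sparse_set_def, rule packing_premeasure_sparse_portion)
qed

text \<open>The digits of a sparse point in positions \<open>m k + 1\<close> to \<open>n k\<close>
  vanish, so the point exceeds its truncation to \<open>m k\<close> digits by at most
  \<open>2 ^ - n k\<close>. The finitely many closed intervals obtained this way also cover the
  closure.\<close>

lemma sparse_set_cover:
  defines "n \<equiv> \<lambda>k. tower (2*k+1)" and "m \<equiv> \<lambda>k. tower (2*k)"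
  assumes "x \<in> sparse_set"
  shows "\<exists>j<2 ^ m k. real j / 2 ^ m k \<le> x \<and> x \<le> real j / 2 ^ m k + 1 / 2 ^ n k"
proof -
  let ?K = "\<Union>j<2 ^ m k. {real j / 2 ^ m k..real j / 2 ^ m k + 1 / 2 ^ n k}"
  have "x \<in> ?K" if x: "x \<in> sparse_points" for x
  proof -
    have mn: "m k \<le> n k" by (simp add: m_def n_def)
    obtain c where c: "\<lfloor>x * 2 ^ n k\<rfloor> = 2 ^ (n k - m k) * c"
      using x unfolding sparse_points_def n_def m_def by blast
    have "0 \<le> \<lfloor>x * 2 ^ n k\<rfloor>" using x by (simp add: sparse_points_def)
    then have c0: "0 \<le> c" using c by (simp add: zero_le_mult_iff)
    have b: "2 ^ (n k - m k) * real_of_int c \<le> x * 2 ^ n k" "x * 2 ^ n k < 2 ^ (n k - m k) * real_of_int c + 1"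
      using floor_correct[of "x * 2 ^ n k"] by (simp_all add: c)
    have lo: "real_of_int c / 2 ^ m k \<le> x" and hi: "x \<le> real_of_int c / 2 ^ m k + 1 / 2 ^ n k"
      using b mn by (simp_all add: power_diff field_simps)
    have "x < 1" using x by (simp add: sparse_points_def)
    with lo have "real_of_int c / 2 ^ m k < 1" by linarith
    then have "real_of_int c < real_of_int (2 ^ m k)" by (simp add: field_simps)
    then have "c < 2 ^ m k" by (simp only: of_int_less_iff)
    then have "nat c < 2 ^ m k" using c0 by (simp add: nat_less_iff)
    moreover have "real (nat c) = real_of_int c" using c0 by simp
    ultimately show ?thesis using lo hi by (intro UN_I[of "nat c"]) auto
  qed
  then have "sparse_points \<subseteq> ?K" by blast
  then have "sparse_set \<subseteq> ?K"
    unfolding sparse_set_def by (rule closure_minimal) auto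
  then show ?thesis using assms(3) by fastforce
qed

section \<open>Counting dyadic intervals that meet the sparse set\<close>

lemma finite_dyadic_intervals [simp]: "finite (dyadic_intervals n)"
  by (simp add: dyadic_intervals_def)

lemma card_dyadic_intervals_le: "card (dyadic_intervals n) \<le> 2 ^ n"
proof -
  have "card (dyadic_intervals n) \<le> card {0..(2::nat) ^ n - 1}"
    unfolding dyadic_intervals_def by (rule card_image_le) simp
  then show ?thesis by simp
qed

text \<open>Each covering interval is itself one cell \<open>[J, J + 1]\<close> of the grid of order
  \<open>n k\<close>. A closed cell meeting it is this cell or one of its two neighbours, whence the
  factor \<open>3\<close>.\<close>

lemma card_dyadic_meeting_sparse_set:
  defines "n \<equiv> \<lambda>k. tower (2*k+1)" and "m \<equiv> \<lambda>k. tower (2*k)"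
  shows "card {Q \<in> dyadic_intervals (n k). Q \<inter> sparse_set \<noteq> {}} \<le> 3 * 2 ^ m k"
proof -
  let ?f = "\<lambda>(j, t). {(real j * 2 ^ (n k - m k) + real t - 1) / 2 ^ n k
                      .. (real j * 2 ^ (n k - m k) + real t) / 2 ^ n k}"
  let ?J = "{..<(2::nat) ^ m k} \<times> {..<3::nat}"
  have mn: "m k \<le> n k" by (simp add: m_def n_def)
  have "{Q \<in> dyadic_intervals (n k). Q \<inter> sparse_set \<noteq> {}} \<subseteq> ?f ` ?J"
  proof
    fix Q assume Q: "Q \<in> {Q \<in> dyadic_intervals (n k). Q \<inter> sparse_set \<noteq> {}}"
    then obtain x where x: "x \<in> Q" "x \<in> sparse_set" by blast
    from Q obtain i :: nat where Q: "Q = {real i / 2 ^ n k .. (real i + 1) / 2 ^ n k}"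
      by (auto simp: dyadic_intervals_def)
    obtain j where j: "j < 2 ^ m k" "real j / 2 ^ m k \<le> x" "x \<le> real j / 2 ^ m k + 1 / 2 ^ n k"
      using sparse_set_cover[OF x(2), of k] by (auto simp: n_def m_def)
    define J where "J = j * 2 ^ (n k - m k)"
    have J: "real j / 2 ^ m k = real J / 2 ^ n k"
    proof -
      have "(2::real) ^ n k = 2 ^ m k * 2 ^ (n k - m k)"
        using mn by (simp flip: power_add)
      then show ?thesis by (simp add: J_def)
    qed
    have "real i \<le> real J + 1" "real J \<le> real i + 1"
    proof -
      have "real i / 2 ^ n k \<le> (real J + 1) / 2 ^ n k" "real J / 2 ^ n k \<le> (real i + 1) / 2 ^ n k"
        using x(1) j unfolding Q J by (auto simp: add_divide_distrib)
      then show "real i \<le> real J + 1" "real J \<le> real i + 1"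
        by (simp_all add: divide_le_cancel)
    qed
    then have iJ: "i \<le> J + 1" "J \<le> i + 1" by linarith+
    \<comment> \<open>The offset is shifted by one to stay natural; \<open>J \<le> i + 1\<close>
      makes the subtraction exact. Subtracting \<open>1\<close> inside the reals in
      \<open>?f\<close> also accommodates \<open>J = 0\<close>.\<close>
    have "Q = ?f (j, i + 1 - J)"
      using iJ by (simp add: Q of_nat_diff J_def)
    moreover have "(j, i + 1 - J) \<in> ?J" using iJ j(1) by auto
    ultimately show "Q \<in> ?f ` ?J" by blast
  qed
  then have "card {Q \<in> dyadic_intervals (n k). Q \<inter> sparse_set \<noteq> {}} \<le> card (?f ` ?J)"
    by (rule card_mono[rotated]) simp
  also have "\<dots> \<le> card ?J" by (rule card_image_le) simp
  finally show ?thesis by simp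
qed

section \<open>The random fractal\<close>

text \<open>Chosen such that \<open>2 powr decay n\<close> bounds, up to the factor \<open>3\<close>, the number of
  dyadic intervals of order \<open>n\<close> that meet the sparse set.\<close>

definition decay :: "nat \<Rightarrow> real" where
  "decay n = (if n \<in> range (\<lambda>k. tower (2*k+1)) then sqrt (real n) else real n)"

text \<open>Against at most \<open>3 * 2 powr decay n\<close> relevant intervals, base
  \<open>4\<close> leaves an expected number of hits of at most \<open>3 * 2 powr - decay n\<close>,
  which is summable.\<close>

definition hit_rate :: "nat \<Rightarrow> real" where
  "hit_rate n = 4 powr - decay n"

lemma decay_tower: "decay (tower (2*k+1)) = real (tower (2*k))"
proof -
  have "tower (2*k+1) \<in> range (\<lambda>k. tower (2*k+1))" by blast
  moreover have "tower (2*k+1) = (tower (2*k))\<^sup>2" using tower_Suc[of "2*k"] by simp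
  ultimately show ?thesis by (simp only: decay_def if_True) simp
qed

lemma sqrt_le_decay: "sqrt (real n) \<le> decay n"
proof -
  have "real n \<le> (real n)\<^sup>2" by (metis of_nat_le_iff of_nat_power power2_nat_le_imp_le power2_eq_square le_square)
  then show ?thesis by (auto simp: decay_def intro: real_le_lsqrt)
qed

lemma decay_nonneg: "0 \<le> decay n"
  by (simp add: decay_def)

lemma hit_rate_pos: "0 < hit_rate n"
  by (simp add: hit_rate_def)

lemma hit_rate_le_1: "hit_rate n \<le> 1"
  using powr_mono[of "- decay n" 0 4] decay_nonneg[of n] by (simp add: hit_rate_def)

lemma elog2_hit_rate: "elog2 (hit_rate n) = ereal (- 2 * decay n)"
proof -
  have "log 2 4 = (2::real)" using log_nat_power[of 2 2 2] by simp
  then show ?thesis using hit_rate_pos[of n] by (simp add: elog2_def hit_rate_def log_powr)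
qed

text \<open>The quotients are nonpositive because the rates are at most \<open>1\<close>. Along
  \<open>tower (2*k+1)\<close> they equal \<open>- 2 / tower (2*k)\<close> and tend to
  \<open>0\<close>, which determines the upper limit.\<close>

lemma limsup_elog2_hit_rate: "limsup (\<lambda>n. elog2 (hit_rate n) / ereal (real n)) = 0"
proof (rule antisym)
  let ?X = "\<lambda>n. elog2 (hit_rate n) / ereal (real n)"
  have X: "?X n = ereal (- 2 * decay n / real n)" if "n > 0" for n
    using that by (simp add: elog2_hit_rate)
  show "limsup ?X \<le> 0"
  proof (rule Limsup_bounded, rule eventually_mono[OF eventually_gt_at_top[of 0]])
    fix n :: nat assume "0 < n"
    then show "?X n \<le> 0" unfolding X[OF \<open>0 < n\<close>] using decay_nonneg[of n] by simp
  qed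
  let ?t = "\<lambda>k. tower (2*k+1)"
  have t: "strict_mono ?t" by (auto simp: strict_mono_def tower_def)
  have "- 2 * decay (?t k) / real (?t k) = - 2 / real (tower (2*k))" for k
    unfolding decay_tower using tower_Suc[of "2*k"] by (simp add: power2_eq_square)
  then have eq: "?X (?t k) = ereal (- 2 / real (tower (2*k)))" for k
    using X[of "?t k"] by simp
  have "filterlim (\<lambda>k. tower (2*k)) at_top sequentially"
    by (rule filterlim_subseq) (auto simp: strict_mono_def tower_def)
  moreover have "((\<lambda>n::nat. - 2 / real n) \<longlongrightarrow> 0) at_top" by real_asymp
  ultimately have "(\<lambda>k. - 2 / real (tower (2*k))) \<longlonglongrightarrow> 0"
    by (rule filterlim_compose[rotated])
  then have "(?X \<circ> ?t) \<longlonglongrightarrow> 0"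
    using eq by (simp add: o_def zero_ereal_def)
  then have "limsup (?X \<circ> ?t) = 0" by (intro lim_imp_Limsup) auto
  with limsup_subseq_mono[OF t, of ?X] show "0 \<le> limsup ?X" by simp
qed

section \<open>Expected number of hit intervals meeting the sparse set\<close>

definition hitting_intervals :: "nat \<Rightarrow> real set set" where
  "hitting_intervals n = {Q \<in> dyadic_intervals n. Q \<inter> sparse_set \<noteq> {}}"

lemma finite_hitting_intervals [simp]: "finite (hitting_intervals n)"
  by (simp add: hitting_intervals_def)

lemma card_hitting_intervals_le: "real (card (hitting_intervals n)) \<le> 3 * 2 powr decay n"
proof (cases "n \<in> range (\<lambda>k. tower (2*k+1))")
  case True
  then obtain k where n: "n = tower (2*k+1)" by blast
  have "real (card (hitting_intervals n)) \<le> real (3 * 2 ^ tower (2*k))"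
    unfolding hitting_intervals_def n of_nat_le_iff by (rule card_dyadic_meeting_sparse_set)
  then show ?thesis by (simp only: n decay_tower) (simp add: powr_realpow)
next
  case False
  have "card (hitting_intervals n) \<le> card (dyadic_intervals n)"
    unfolding hitting_intervals_def by (rule card_mono) auto
  also have "\<dots> \<le> 2 ^ n" by (rule card_dyadic_intervals_le)
  finally have "real (card (hitting_intervals n)) \<le> real (2 ^ n)" by (simp only: of_nat_le_iff)
  also have "\<dots> \<le> 3 * 2 ^ n" by simp
  finally show ?thesis using False by (simp add: decay_def powr_realpow)
qed

lemma card_times_hit_rate_le:
  "real (card (hitting_intervals n)) * hit_rate n \<le> 3 * 2 powr - sqrt (real n)"
proof -
  have "real (card (hitting_intervals n)) * hit_rate n \<le> 3 * 2 powr decay n * hit_rate n"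
    using hit_rate_pos[of n] by (intro mult_right_mono card_hitting_intervals_le) auto
  also have "\<dots> = 3 * 2 powr - decay n"
    using powr_powr[of 2 2 "- decay n"] by (simp add: hit_rate_def flip: powr_add)
  also have "\<dots> \<le> 3 * 2 powr - sqrt (real n)"
    using sqrt_le_decay[of n] by (intro mult_left_mono powr_mono) auto
  finally show ?thesis .
qed

lemma summable_hit_bound: "summable (\<lambda>n. 3 * 2 powr - sqrt (real n))"
proof (rule summable_comparison_test_bigo)
  show "summable (\<lambda>n. norm (1 / real n ^ 2))"
    using inverse_power_summable[of 2, where 'a = real] by (simp add: inverse_eq_divide)
  show "(\<lambda>n. 3 * 2 powr - sqrt (real n)) \<in> O(\<lambda>n. 1 / real n ^ 2)"
    by real_asymp
qed

section \<open>Hitting variables on a completed product space\<close>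

lemma (in prob_space) covariance_indicator:
  assumes [measurable]: "A \<in> events" "B \<in> events"
  shows "covariance M (indicator A) (indicator B) = prob (A \<inter> B) - prob A * prob B"
proof -
  have integrable_indicator [simp]: "integrable M (\<lambda>\<omega>. indicat_real X \<omega>)" if "X \<in> events" for X
    using that by (intro integrable_real_indicator) (auto simp: less_top[symmetric])
  have "covariance M (indicator A) (indicator B)
      = (\<integral>\<omega>. indicator (A \<inter> B) \<omega> - prob B * indicator A \<omega> - prob A * indicator B \<omega> + prob A * prob B \<partial>M)"
    unfolding covariance_def
    by (intro Bochner_Integration.integral_cong) (auto simp: algebra_simps indicator_inter_arith)
  also have "\<dots> = prob (A \<inter> B) - prob B * prob A - prob A * prob B + prob A * prob B"
    using assms integrable_indicator[of "A \<inter> B"] by (simp add: prob_space)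
  finally show ?thesis by simp
qed

definition uniform_sequence :: "(nat \<Rightarrow> real) measure" where
  "uniform_sequence = PiM UNIV (\<lambda>_. uniform_measure lborel {0..1})"

text \<open>Completing the product space makes the event that the fractal meets the sparse set measurable,
  as a subset of a null set.\<close>

definition fractal_space :: "(nat \<Rightarrow> real) measure" where
  "fractal_space = completion uniform_sequence"

text \<open>Distinct intervals of one order read distinct coordinates and are hit independently.
  Different orders share coordinates; this is harmless, since covariances enter only within one
  order and Borel--Cantelli is applied in its convergence form.\<close>

definition hit_event :: "nat \<Rightarrow> real set \<Rightarrow> (nat \<Rightarrow> real) set" where
  "hit_event n Q = {\<omega>. \<omega> (to_nat_on (dyadic_intervals n) Q) \<le> hit_rate n}"

definition hit :: "nat \<Rightarrow> real set \<Rightarrow> (nat \<Rightarrow> real) \<Rightarrow> real" where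
  "hit n Q = indicator (hit_event n Q)"

lemma prob_space_uniform: "prob_space (uniform_measure lborel {0..1::real})"
  by (rule prob_space_uniform_measure) auto

interpretation uniform: product_prob_space "\<lambda>_::nat. uniform_measure lborel {0..1::real}" UNIV
  using prob_space_uniform
  by (simp add: product_prob_space_def product_prob_space_axioms_def product_sigma_finite_def
      prob_space_imp_sigma_finite)

lemma prob_space_fractal_space: "prob_space fractal_space"
  unfolding fractal_space_def uniform_sequence_def
  by (rule prob_space.prob_space_completion) (rule uniform.P.prob_space_axioms)

interpretation fractal: prob_space fractal_space
  by (rule prob_space_fractal_space)

lemma space_fractal_space [simp]: "space fractal_space = UNIV"
  by (simp add: fractal_space_def uniform_sequence_def space_PiM)

lemma measure_uniform_le:
  assumes "0 \<le> p" "p \<le> 1"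
  shows "measure (uniform_measure lborel {0..1::real}) {..p} = p"
proof -
  have "{0..1} \<inter> {..p} = {0..p}" using assms by auto
  then show ?thesis using assms by (simp add: measure_uniform_measure)
qed

text \<open>The event is a cylinder over \<open>J\<close>. Singletons will give the hitting
  probabilities, pairs the joint ones.\<close>

lemma prob_coordinates_le:
  assumes "0 \<le> p" "p \<le> 1" "finite J"
  shows "{\<omega>. \<forall>i\<in>J. \<omega> i \<le> p} \<in> sets uniform_sequence"
    and "measure fractal_space {\<omega>. \<forall>i\<in>J. \<omega> i \<le> p} = p ^ card J"
proof -
  let ?U = "\<lambda>_::nat. uniform_measure lborel {0..1::real}"
  have eq: "{\<omega>. \<forall>i\<in>J. \<omega> i \<le> p} = prod_emb UNIV ?U J (Pi\<^sub>E J (\<lambda>_. {..p}))"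
    by (auto simp: prod_emb_def space_PiM)
  show S: "{\<omega>. \<forall>i\<in>J. \<omega> i \<le> p} \<in> sets uniform_sequence"
    unfolding eq uniform_sequence_def using assms(3)
    by (intro measurable_prod_emb sets_PiM_I_finite) auto
  show "measure fractal_space {\<omega>. \<forall>i\<in>J. \<omega> i \<le> p} = p ^ card J"
    unfolding fractal_space_def measure_completion[OF S] unfolding uniform_sequence_def eq
    by (subst uniform.measure_PiM_emb) (use assms in \<open>auto simp: measure_uniform_le\<close>)
qed

lemma hit_event_sets_uniform: "hit_event n Q \<in> sets uniform_sequence"
  using prob_coordinates_le(1)[of "hit_rate n" "{to_nat_on (dyadic_intervals n) Q}"]
    hit_rate_pos[of n] hit_rate_le_1[of n]
  by (simp add: hit_event_def)

lemma hit_event_sets [measurable]: "hit_event n Q \<in> sets fractal_space"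
  unfolding fractal_space_def by (rule sets_completionI_sets[OF hit_event_sets_uniform])

lemma prob_hit_event: "fractal.prob (hit_event n Q) = hit_rate n"
  using prob_coordinates_le(2)[of "hit_rate n" "{to_nat_on (dyadic_intervals n) Q}"]
    hit_rate_pos[of n] hit_rate_le_1[of n]
  by (simp add: hit_event_def)

lemma prob_hit_event_Int:
  assumes "Q \<in> dyadic_intervals n" "Q' \<in> dyadic_intervals n" "Q \<noteq> Q'"
  shows "fractal.prob (hit_event n Q \<inter> hit_event n Q') = (hit_rate n)\<^sup>2"
proof -
  let ?i = "to_nat_on (dyadic_intervals n)"
  have "?i Q \<noteq> ?i Q'"
    using assms by (simp add: countable_finite)
  then have "card {?i Q, ?i Q'} = 2" by simp
  moreover have "hit_event n Q \<inter> hit_event n Q' = {\<omega>. \<forall>i\<in>{?i Q, ?i Q'}. \<omega> i \<le> hit_rate n}"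
    by (auto simp: hit_event_def)
  ultimately show ?thesis
    using prob_coordinates_le(2)[of "hit_rate n" "{?i Q, ?i Q'}"] hit_rate_pos[of n] hit_rate_le_1[of n]
    by simp
qed

lemma limsup_random_fractal_hit: "limsup_random_fractal fractal_space hit"
proof
  show "hit n Q \<in> borel_measurable fractal_space" for n Q
    unfolding hit_def by measurable
qed (auto simp: hit_def indicator_def)

section \<open>Indices and the Correlation Condition\<close>

lemma hit_prob_hit: "hit_prob fractal_space hit n Q = hit_rate n"
proof -
  have "{\<omega> \<in> space fractal_space. hit n Q \<omega> = 1} = hit_event n Q"
    by (auto simp: hit_def indicator_def)
  then show ?thesis by (simp add: hit_prob_def prob_hit_event)
qed

lemma hit_prob_image: "hit_prob fractal_space hit n ` dyadic_intervals n = {hit_rate n}"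
  by (simp add: hit_prob_hit image_constant_conv dyadic_intervals_def)

lemma gamma1_hit: "gamma1 fractal_space hit = 0"
  by (simp add: gamma1_def hit_prob_image limsup_elog2_hit_rate)

lemma gamma2_hit: "gamma2 fractal_space hit = 0"
  by (simp add: gamma2_def hit_prob_image limsup_elog2_hit_rate)

lemma covariance_hit:
  assumes "Q \<in> dyadic_intervals n" "Q' \<in> dyadic_intervals n" "Q \<noteq> Q'"
  shows "covariance fractal_space (hit n Q) (hit n Q') = 0"
  unfolding hit_def
  by (simp add: fractal.covariance_indicator prob_hit_event prob_hit_event_Int[OF assms] power2_eq_square)

text \<open>Distinct intervals have covariance \<open>0\<close>, strictly below the threshold
  because \<open>hit_rate n\<close> is positive. Only \<open>Q\<close> itself can be
  counted.\<close>

lemma correlation_count_hit_le: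
  assumes "\<epsilon> > 0"
  shows "correlation_count fractal_space hit n \<epsilon> \<le> 1"
  unfolding correlation_count_def
proof (rule Max.boundedI)
  show "(\<lambda>Q. card {Q' \<in> dyadic_intervals n. covariance fractal_space (hit n Q) (hit n Q')
       \<ge> \<epsilon> * hit_prob fractal_space hit n Q * hit_prob fractal_space hit n Q'}) ` dyadic_intervals n \<noteq> {}"
    by (simp add: dyadic_intervals_def)
next
  fix c assume "c \<in> (\<lambda>Q. card {Q' \<in> dyadic_intervals n. covariance fractal_space (hit n Q) (hit n Q')
       \<ge> \<epsilon> * hit_prob fractal_space hit n Q * hit_prob fractal_space hit n Q'}) ` dyadic_intervals n"
  then obtain Q where Q: "Q \<in> dyadic_intervals n"
      and c: "c = card {Q' \<in> dyadic_intervals n. covariance fractal_space (hit n Q) (hit n Q')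
       \<ge> \<epsilon> * hit_prob fractal_space hit n Q * hit_prob fractal_space hit n Q'}"
    by blast
  have "0 < \<epsilon> * hit_rate n * hit_rate n" using assms hit_rate_pos[of n] by simp
  then have "{Q' \<in> dyadic_intervals n. covariance fractal_space (hit n Q) (hit n Q')
       \<ge> \<epsilon> * hit_prob fractal_space hit n Q * hit_prob fractal_space hit n Q'} \<subseteq> {Q}"
    using covariance_hit[OF Q] by (force simp: hit_prob_hit)
  then have "c \<le> card {Q}" unfolding c by (rule card_mono[rotated]) simp
  then show "c \<le> 1" by simp
qed simp

lemma correlation_condition_hit: "correlation_condition fractal_space hit 0"
  unfolding correlation_condition_def
proof (intro conjI allI impI)
  fix \<epsilon> :: real assume "\<epsilon> > 0"
  show "limsup (\<lambda>n. elog2 (real (correlation_count fractal_space hit n \<epsilon>)) / ereal (real n)) \<le> ereal 0"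
  proof (rule Limsup_bounded, rule eventually_mono[OF eventually_gt_at_top[of 0]])
    fix n :: nat assume "0 < n"
    \<comment> \<open>For large \<open>\<epsilon>\<close> even \<open>Q\<close> itself may miss the
      threshold; count \<open>0\<close> then contributes minus infinity by the convention in
      \<open>elog2\<close>, and count \<open>1\<close> contributes \<open>0\<close>.\<close>
    consider "correlation_count fractal_space hit n \<epsilon> = 0" | "correlation_count fractal_space hit n \<epsilon> = 1"
      using correlation_count_hit_le[OF \<open>\<epsilon> > 0\<close>, of n] by linarith
    then show "elog2 (real (correlation_count fractal_space hit n \<epsilon>)) / ereal (real n) \<le> ereal 0"
      using \<open>0 < n\<close> by cases (simp_all add: elog2_def)
  qed
qed simp

section \<open>Almost sure disjointness of the fractal and the sparse set\<close>

lemma AE_limsup_fractal_hit: "AE \<omega> in fractal_space. limsup_fractal hit \<omega> \<inter> sparse_set = {}"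
proof -
  define B where "B n = (\<Union>Q\<in>hitting_intervals n. hit_event n Q)" for n
  have B [measurable]: "B n \<in> sets fractal_space" for n
    unfolding B_def by (intro sets.finite_UN) auto
  have prob_B: "fractal.prob (B n) \<le> 3 * 2 powr - sqrt (real n)" for n
  proof -
    have "fractal.prob (B n) \<le> (\<Sum>Q\<in>hitting_intervals n. fractal.prob (hit_event n Q))"
      unfolding B_def by (rule fractal.finite_measure_subadditive_finite) auto
    also have "\<dots> \<le> 3 * 2 powr - sqrt (real n)"
      using card_times_hit_rate_le[of n] by (simp add: prob_hit_event)
    finally show ?thesis .
  qed
  \<comment> \<open>The union bound makes the probabilities of the \<open>B n\<close> summable, so
    almost surely only finitely many occur; a common point of the two sets would force infinitely
    many.\<close>
  have "AE \<omega> in fractal_space. eventually (\<lambda>n. \<omega> \<in> space fractal_space - B n) sequentially"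
  proof (rule borel_cantelli_AE1)
    show "summable (\<lambda>n. fractal.prob (B n))"
      by (rule summable_comparison_test[OF _ summable_hit_bound]) (use prob_B in auto)
  qed (auto simp: less_top[symmetric])
  then show ?thesis
  proof (rule AE_mp, intro AE_I2 impI)
    fix \<omega> assume "eventually (\<lambda>n. \<omega> \<in> space fractal_space - B n) sequentially"
    then obtain N where N: "\<And>n. n \<ge> N \<Longrightarrow> \<omega> \<notin> B n"
      by (auto simp: eventually_sequentially)
    show "limsup_fractal hit \<omega> \<inter> sparse_set = {}"
    proof (rule ccontr)
      assume "limsup_fractal hit \<omega> \<inter> sparse_set \<noteq> {}"
      then obtain x where x: "x \<in> limsup_fractal hit \<omega>" "x \<in> sparse_set" by blast
      \<comment> \<open>The maximum with \<open>1\<close> is taken because the intersection defining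
        the upper limit starts at \<open>1\<close>.\<close>
      from x(1) have "x \<in> (\<Union>n\<in>{max 1 N..}. fractal_level hit n \<omega>)"
        unfolding limsup_fractal_def by (rule INT_D) simp
      then obtain n Q where n: "n \<ge> N" and Q: "Q \<in> dyadic_intervals n" "hit n Q \<omega> = 1" "x \<in> Q"
        by (auto simp: fractal_level_def)
      have "Q \<in> hitting_intervals n" using Q x(2) by (auto simp: hitting_intervals_def)
      moreover have "\<omega> \<in> hit_event n Q" using Q(2) by (simp add: hit_def indicator_def split: if_splits)
      ultimately have "\<omega> \<in> B n" by (auto simp: B_def)
      with N[OF n] show False by blast
    qed
  qed
qed

theorem proposition1p1:
  shows "\<exists>(G :: real set) (M :: (nat \<Rightarrow> real) measure)
            (Z :: nat \<Rightarrow> real set \<Rightarrow> (nat \<Rightarrow> real) \<Rightarrow> real).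
    closed G \<and> G \<subseteq> {0..1} \<and> packing_dim G = 1 \<and>
    limsup_random_fractal M Z \<and>
    gamma1 M Z = 0 \<and> gamma2 M Z = 0 \<and>
    correlation_condition M Z 0 \<and>
    {\<omega> \<in> space M. limsup_fractal Z \<omega> \<inter> G \<noteq> {}} \<in> sets M \<and>
    measure M {\<omega> \<in> space M. limsup_fractal Z \<omega> \<inter> G \<noteq> {}} = 0"
proof (intro exI conjI)
  let ?H = "{\<omega> \<in> space fractal_space. limsup_fractal hit \<omega> \<inter> sparse_set \<noteq> {}}"
  obtain N where N: "?H \<subseteq> N" "N \<in> null_sets fractal_space"
    using AE_limsup_fractal_hit by (auto elim!: AE_E simp: null_sets_def)
  then have "?H \<in> null_sets fractal_space"
    unfolding fractal_space_def by (rule null_sets_completion_subset)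
  then show "?H \<in> sets fractal_space" "measure fractal_space ?H = 0"
    by (auto simp: measure_def null_sets_def)
  show "closed sparse_set" by (simp add: sparse_set_def)
qed (rule sparse_set_subset packing_dim_sparse_set limsup_random_fractal_hit gamma1_hit gamma2_hit
       correlation_condition_hit)+

end
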